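(* Let $n\ge 0$ be an integer, let $[p,q]$ be a compact real interval, let $x_0,x_1,\dots,x_n\in[p,q]$ be distinct numbers, let $x\in[p,q]$ be distinct from $x_0,\dots,x_n$, and let $f\in C^{2n+1}[p,q]$. Let $I$ be the smallest closed interval containing $x,x_0,\dots,x_n$, and let $N_r(x)$, $\tilde N^{(r)}_{0,1,\dots,n}[x]$, $A_r(x)$, $\tilde A^{(r)}_{0,1,\dots,n}[x]$ be as defined in the context; write $N_r=N_r(x)$ and $A_r=A_r(x)$. Given numbers $a_0=1,a_1,\dots,a_n$ and $h\neq 0$, put $$\gamma_k=\frac{h^{k+1}}{k+1}+a_1\frac{h^{k+2}}{k+2}+\dots+a_{n-k}\frac{h^{n+1}}{n+1},\qquad k=0,1,\dots,n.$$ (i) Let $a_0=1$ and $a_k=-(a_0N_k+a_1N_{k-1}+\dots+a_{k-1}N_1)$ for $k=1,\dots,n$. Then, for $h\ne0$ with $x+h\in[p,q]$, there are $\xi_0,\dots,\xi_n\in I$ such that $$\int_x^{x+h}f(s)\,ds=\sum_{k=0}^{n}\tilde N^{(k)}_{0,1,\dots,n}[x]\,\gamma_k+\prod_{i=0}^{n}(x-x_i)\left(\frac{f^{(n+1)}(\xi_n)}{(n+1)!}\gamma_0+\frac{f^{(n+2)}(\xi_{n-1})}{(n+2)!}\gamma_1+\dots+\frac{f^{(2n+1)}(\xi_0)}{(2n+1)!}\gamma_n\right)+O(h^{n+2}).$$ (ii) Let instead $a_0=1$ and $a_k=-(a_0A_k+a_1A_{k-1}+\dots+a_{k-1}A_1)$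 for $k=1,\dots,n$. Then, for $h\ne0$ with $x+h\in[p,q]$, there are $\xi_0,\dots,\xi_n\in I$ such that $$\int_x^{x+h}f(s)\,ds=\sum_{k=0}^{n}\tilde A^{(k)}_{0,1,\dots,n}[x]\,\gamma_k+\prod_{i=0}^{n}(x-x_i)\left(\frac{f^{(n+1)}(\xi_n)}{(n+1)!}\gamma_0+\frac{f^{(n+2)}(\xi_{n-1})}{(n+2)!}\gamma_1+\dots+\frac{f^{(2n+1)}(\xi_0)}{(2n+1)!}\gamma_n\right)+O(h^{n+2}).$$ Here $O(h^{n+2})$ denotes a term bounded in absolute value by $C|h|^{n+2}$ with $C$ independent of $h$ ($f$, $x$, $x_0,\dots,x_n$, $p$, $q$ being fixed).
   Context: For an integer $r\ge 0$ define the following quantities, where vertical bars denote $2\times2$ determinants. Neville scheme: for $j=0,\dots,n$ put $N^{(r)}_j[x]=\dfrac{1}{(x_j-x)^r}$ and $\tilde N^{(r)}_j[x]=\dfrac{f(x_j)}{(x_j-x)^r}$. For $i=1,\dots,n$ and $j=0,\dots,n-i$ put $$N^{(r)}_{j,j+1,\dots,i+j}[x]=\frac{1}{x_{i+j}-x_j}\begin{vmatrix} N^{(r)}_{j,j+1,\dots,i+j-1}[x] & x_j-x\\ N^{(r)}_{j+1,j+2,\dots,i+j}[x] & x_{i+j}-x\end{vmatrix},$$ and define $\tilde N^{(r)}_{j,j+1,\dots,i+j}[x]$ by the same recursion with $\tilde N$ in place of $N$. Set $N_r(x)=N^{(r)}_{0,1,\dots,n}[x]$. Aitken scheme: for $j=0,\dots,n$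 put $A^{(r)}_j[x]=\dfrac{1}{(x_j-x)^r}$ and $\tilde A^{(r)}_j[x]=\dfrac{f(x_j)}{(x_j-x)^r}$. For $i=0,\dots,n-1$ and $j=i+1,\dots,n$ put $$A^{(r)}_{0,1,\dots,i-1,i,j}[x]=\frac{1}{x_j-x_i}\begin{vmatrix} A^{(r)}_{0,1,\dots,i-1,i}[x] & x_i-x\\ A^{(r)}_{0,1,\dots,i-1,j}[x] & x_j-x\end{vmatrix}$$ (for $i=0$ the first column consists of $A^{(r)}_0[x]$ and $A^{(r)}_j[x]$), and define $\tilde A^{(r)}_{0,1,\dots,i,j}[x]$ by the same recursion with $\tilde A$ in place of $A$. Set $A_r(x)=A^{(r)}_{0,1,\dots,n}[x]$. *)

theory Defs
  imports "HOL-Analysis.Analysis"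
begin

text \<open>
  Derivatives are taken within the set, so that on \<open>{p..q}\<close> they are one-sided at the end points.
  Values of the iterates outside the set carry no meaning.
\<close>

definition iter_deriv_on :: "real set \<Rightarrow> nat \<Rightarrow> (real \<Rightarrow> real) \<Rightarrow> real \<Rightarrow> real" where
  "iter_deriv_on S k f = ((\<lambda>g t. vector_derivative g (at t within S)) ^^ k) f"

definition C_on :: "nat \<Rightarrow> real set \<Rightarrow> (real \<Rightarrow> real) \<Rightarrow> bool" where
  "C_on m S f \<longleftrightarrow>
     (\<forall>k<m. iter_deriv_on S k f differentiable_on S) \<and>
     (\<forall>k\<le>m. continuous_on S (iter_deriv_on S k f))"

definition det2 :: "real \<Rightarrow> real \<Rightarrow> real \<Rightarrow> real \<Rightarrow> real" where
  "det2 a b c d = det (vector [vector [a, b], vector [c, d]] :: real ^ 2 ^ 2)"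

lemma det2_eq: "det2 a b c d = a * d - b * c"
  by (simp add: det2_def det_2)

text \<open>
  Both schemes are stated for an arbitrary starting column \<open>v\<close>.
  \<open>neville xs x v i j\<close> is the entry with index list \<open>j, j+1, \<dots>, i+j\<close>;
  \<open>aitken xs x v i j\<close> is the entry with index list \<open>0, 1, \<dots>, i-1, j\<close>.
\<close>

fun neville :: "(nat \<Rightarrow> real) \<Rightarrow> real \<Rightarrow> (nat \<Rightarrow> real) \<Rightarrow> nat \<Rightarrow> nat \<Rightarrow> real" where
  "neville xs x v 0 j = v j"
| "neville xs x v (Suc i) j =
     1 / (xs (Suc i + j) - xs j) *
     det2 (neville xs x v i j)       (xs j - x)
          (neville xs x v i (Suc j)) (xs (Suc i + j) - x)"

fun aitken :: "(nat \<Rightarrow> real) \<Rightarrow> real \<Rightarrow> (nat \<Rightarrow> real) \<Rightarrow> nat \<Rightarrow> nat \<Rightarrow> real" where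
  "aitken xs x v 0 j = v j"
| "aitken xs x v (Suc i) j =
     1 / (xs j - xs i) *
     det2 (aitken xs x v i i) (xs i - x)
          (aitken xs x v i j) (xs j - x)"

definition N_val :: "(nat \<Rightarrow> real) \<Rightarrow> nat \<Rightarrow> nat \<Rightarrow> real \<Rightarrow> real" where
  "N_val xs n r x = neville xs x (\<lambda>j. 1 / (xs j - x) ^ r) n 0"

definition Nt_val :: "(real \<Rightarrow> real) \<Rightarrow> (nat \<Rightarrow> real) \<Rightarrow> nat \<Rightarrow> nat \<Rightarrow> real \<Rightarrow> real" where
  "Nt_val f xs n r x = neville xs x (\<lambda>j. f (xs j) / (xs j - x) ^ r) n 0"

definition A_val :: "(nat \<Rightarrow> real) \<Rightarrow> nat \<Rightarrow> nat \<Rightarrow> real \<Rightarrow> real" where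
  "A_val xs n r x = aitken xs x (\<lambda>j. 1 / (xs j - x) ^ r) n n"

definition At_val :: "(real \<Rightarrow> real) \<Rightarrow> (nat \<Rightarrow> real) \<Rightarrow> nat \<Rightarrow> nat \<Rightarrow> real \<Rightarrow> real" where
  "At_val f xs n r x = aitken xs x (\<lambda>j. f (xs j) / (xs j - x) ^ r) n n"

definition gamma_coeff :: "(nat \<Rightarrow> real) \<Rightarrow> nat \<Rightarrow> real \<Rightarrow> nat \<Rightarrow> real" where
  "gamma_coeff a n h k = (\<Sum>m\<le>n - k. a m * (h ^ (k + m + 1) / real (k + m + 1)))"

definition hull_interval :: "(nat \<Rightarrow> real) \<Rightarrow> nat \<Rightarrow> real \<Rightarrow> real set" where
  "hull_interval xs n x = {Min (insert x (xs ` {..n})) .. Max (insert x (xs ` {..n}))}"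

end

theory Submission
  imports Defs
begin

text \<open>
  Both schemes evaluate at \<open>x\<close> the interpolation polynomial of their starting column, so they agree.
  Comparing \<open>f\<close> with its Hermite interpolant at the nodes and, to order \<open>r\<close>, at \<open>x\<close>, and counting
  zeros with Rolle's theorem shows that
  \<open>b r = Nt_val f xs n r x + (\<Prod>i\<le>n. x - xs i) * D (n+1+r) (\<eta> r) / (n+1+r)!\<close>, with
  \<open>D k\<close> the \<open>k\<close>-th derivative of \<open>f\<close>, is the convolution of the Taylor coefficients
  \<open>D s x / s!\<close> with \<open>N_val xs n s x\<close>.
  The \<open>a k\<close> are the coefficients of the reciprocal power series of the \<open>N_val xs n k x\<close>; convolving
  with them recovers the Taylor coefficients, and integrating Taylor's formula term by term and
  reordering the double sum produces the \<open>\<gamma>\<close> weights. The points \<open>\<xi> (n - k) = \<eta> k\<close> do not depend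
  on \<open>h\<close>.
\<close>

section \<open>The schemes as values of the interpolation polynomial\<close>

text \<open>The weights \<open>(xs b - y) / (xs b - xs a)\<close> and
  \<open>(y - xs a) / (xs b - xs a)\<close> sum to one, so blending \<open>L1\<close> and
  \<open>L2\<close> keeps the common values on \<open>S\<close>; at \<open>xs a\<close> only
  \<open>L1\<close> survives, at \<open>xs b\<close> only \<open>L2\<close>. Neville takes for
  \<open>S\<close> a block of consecutive indices, Aitken an initial segment.\<close>

lemma interpolation_step:
  fixes L1 L2 :: "real poly" and xs :: "nat \<Rightarrow> real"
  assumes "xs a \<noteq> xs b"
    and "degree L1 \<le> i" "\<forall>k\<in>insert a S. poly L1 (xs k) = v k"
    and "degree L2 \<le> i" "\<forall>k\<in>insert b S. poly L2 (xs k) = v k"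
  shows "\<exists>L. degree L \<le> Suc i \<and> (\<forall>k\<in>insert a (insert b S). poly L (xs k) = v k) \<and>
    poly L x = 1 / (xs b - xs a) * det2 (poly L1 x) (xs a - x) (poly L2 x) (xs b - x)"
proof -
  define L where "L = smult (1 / (xs b - xs a)) (L1 * [:xs b, -1:] - L2 * [:xs a, -1:])"
  have "degree (L1 * [:xs b, -1:]) \<le> Suc i" "degree (L2 * [:xs a, -1:]) \<le> Suc i"
    using degree_mult_le[of L1 "[:xs b, -1:]"] degree_mult_le[of L2 "[:xs a, -1:]"] assms(2,4)
    by simp_all
  then have "degree L \<le> Suc i"
    unfolding L_def by (intro order.trans[OF degree_smult_le] degree_diff_le)
  moreover have poly_L:
    "poly L y = (poly L1 y * (xs b - y) - poly L2 y * (xs a - y)) / (xs b - xs a)" for y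
    by (simp add: L_def left_diff_distrib right_diff_distrib diff_divide_distrib mult.commute)
  have "poly L (xs k) = v k" if "k \<in> insert a (insert b S)" for k
    using that assms unfolding poly_L by (auto simp: divide_simps) (simp_all add: algebra_simps)
  moreover have "poly L x = 1 / (xs b - xs a) * det2 (poly L1 x) (xs a - x) (poly L2 x) (xs b - x)"
    by (simp add: poly_L det2_eq mult.commute)
  ultimately show ?thesis by blast
qed

lemma neville_interpolates:
  assumes "inj_on xs {j..i + j}"
  shows "\<exists>L. degree L \<le> i \<and> (\<forall>k\<in>{j..i + j}. poly L (xs k) = v k) \<and> poly L x = neville xs x v i j"
  using assms
proof (induction i arbitrary: j)
  case 0
  show ?case by (intro exI[of _ "[:v j:]"]) simp
next
  case (Suc i)
  have "inj_on xs {j..i + j}" "inj_on xs {Suc j..i + Suc j}"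
    by (auto intro: inj_on_subset[OF Suc.prems])
  then obtain L1 L2 where
    L1: "degree L1 \<le> i" "\<forall>k\<in>{j..i + j}. poly L1 (xs k) = v k" "poly L1 x = neville xs x v i j" and
    L2: "degree L2 \<le> i" "\<forall>k\<in>{Suc j..i + Suc j}. poly L2 (xs k) = v k"
      "poly L2 x = neville xs x v i (Suc j)"
    using Suc.IH by metis
  have sets: "{j..i + j} = insert j {Suc j..i + j}"
    "{Suc j..i + Suc j} = insert (Suc i + j) {Suc j..i + j}"
    "{j..Suc i + j} = insert j (insert (Suc i + j) {Suc j..i + j})"
    by auto
  have "xs j \<noteq> xs (Suc i + j)"
    using Suc.prems by (auto dest: inj_onD)
  from interpolation_step[OF this L1(1) _ L2(1), of "{Suc j..i + j}" v x] L1(2,3) L2(2,3)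
  show ?case
    unfolding neville.simps sets by simp
qed

text \<open>The condition \<open>i \<le> j\<close> prevents repeated indices: at
  \<open>Suc i\<close> it makes \<open>i\<close> and \<open>j\<close> different, so the denominator
  \<open>xs j - xs i\<close> is nonzero.\<close>

lemma aitken_interpolates:
  assumes "inj_on xs (insert j {..<i})" and "i \<le> j"
  shows "\<exists>L. degree L \<le> i \<and> (\<forall>k\<in>insert j {..<i}. poly L (xs k) = v k) \<and> poly L x = aitken xs x v i j"
  using assms
proof (induction i arbitrary: j)
  case 0
  show ?case by (intro exI[of _ "[:v j:]"]) simp
next
  case (Suc i)
  have "inj_on xs (insert i {..<i})" "inj_on xs (insert j {..<i})"
    using Suc.prems by (auto intro: inj_on_subset[OF Suc.prems(1)] simp: inj_on_def)
  then obtain L1 L2 where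
    L1: "degree L1 \<le> i" "\<forall>k\<in>insert i {..<i}. poly L1 (xs k) = v k" "poly L1 x = aitken xs x v i i" and
    L2: "degree L2 \<le> i" "\<forall>k\<in>insert j {..<i}. poly L2 (xs k) = v k" "poly L2 x = aitken xs x v i j"
    using Suc.IH[of i] Suc.IH[of j] Suc.prems(2) by auto
  have sets: "insert j {..<Suc i} = insert i (insert j {..<i})"
    by auto
  have "xs i \<noteq> xs j"
    using Suc.prems inj_onD[OF Suc.prems(1), of i j] by auto
  from interpolation_step[OF this L1(1,2) L2(1,2), of x] show ?case
    unfolding aitken.simps sets L1(3) L2(3) .
qed

lemma interpolation_poly_unique:
  fixes L M :: "real poly"
  assumes "inj_on xs {..n::nat}" "degree L \<le> n" "degree M \<le> n"
    and "\<And>k. k \<le> n \<Longrightarrow> poly L (xs k) = poly M (xs k)"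
  shows "L = M"
  by (rule poly_eqI_degree[of "xs ` {..n}"])
    (use assms in \<open>auto simp: card_image less_Suc_eq_le\<close>)

lemma neville_eq_poly:
  assumes "inj_on xs {..n}" "degree L \<le> n" "\<And>k. k \<le> n \<Longrightarrow> poly L (xs k) = v k"
  shows "neville xs x v n 0 = poly L x"
proof -
  obtain M where M: "degree M \<le> n" "\<forall>k\<in>{0..n}. poly M (xs k) = v k" "poly M x = neville xs x v n 0"
    using neville_interpolates[of xs 0 n v x] assms(1) by (auto simp: atLeast0AtMost)
  have "L = M"
    by (rule interpolation_poly_unique[OF assms(1,2) M(1)]) (use assms(3) M(2) in auto)
  with M(3) show ?thesis by simp
qed

text \<open>Uniqueness of the interpolation polynomial on \<open>n + 1\<close> distinct nodes forces
  equality, which later reduces the Aitken formula to the Neville one.\<close>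

lemma aitken_eq_neville:
  assumes "inj_on xs {..n}"
  shows "aitken xs x v n n = neville xs x v n 0"
proof -
  have *: "insert n {..<n} = {..n}" by auto
  obtain M where M: "degree M \<le> n" "\<forall>k\<in>{..n}. poly M (xs k) = v k" "poly M x = aitken xs x v n n"
    using aitken_interpolates[of xs n n v x] assms unfolding * by auto
  show ?thesis
    using neville_eq_poly[OF assms M(1), of v x] M(2,3) by simp
qed

text \<open>The constant polynomial 1 interpolates a column of ones. This is the normalization under
  which the \<open>a k\<close> give a reciprocal power series.\<close>

lemma N_val_0:
  assumes "inj_on xs {..n}"
  shows "N_val xs n 0 x = 1"
  unfolding N_val_def by (subst neville_eq_poly[OF assms, of 1]) auto

section \<open>Rolle's theorem with multiplicities\<close>

text \<open>Points are added in increasing order, each giving one new zero between the old maximum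
  and the new point. The last conjunct keeps the earlier zeros below the old maximum, so the new
  zero is distinct from them. Disjointness from \<open>S\<close> is what the count with
  multiplicities relies on.\<close>

lemma Rolle_finite_set:
  fixes f f' :: "real \<Rightarrow> real"
  assumes "finite S" "S \<noteq> {}" "S \<subseteq> {u..v}" "\<And>s. s \<in> S \<Longrightarrow> f s = 0"
    and der: "\<And>t. t \<in> {u..v} \<Longrightarrow> (f has_real_derivative f' t) (at t within {u..v})"
  shows "\<exists>T. finite T \<and> Suc (card T) = card S \<and> T \<subseteq> {u..v} \<and> T \<inter> S = {} \<and>
    (\<forall>t\<in>T. f' t = 0) \<and> (\<forall>t\<in>T. \<exists>s\<in>S. t < s)"
  using assms(1-4)
proof (induction S rule: finite_linorder_max_induct)
  case empty
  then show ?case by simp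
next
  case (insert b A)
  show ?case
  proof (cases "A = {}")
    case True
    then show ?thesis by (intro exI[of _ "{}"]) simp
  next
    case False
    then obtain T where T: "finite T" "Suc (card T) = card A" "T \<subseteq> {u..v}" "T \<inter> A = {}"
      "\<forall>t\<in>T. f' t = 0" "\<forall>t\<in>T. \<exists>s\<in>A. t < s"
      using insert by auto
    define m where "m = Max A"
    have m: "m \<in> A" "\<And>s. s \<in> A \<Longrightarrow> s \<le> m" "m < b"
      using insert.hyps False by (auto simp: m_def)
    have sub: "{m..b} \<subseteq> {u..v}"
      using insert.prems m by auto
    have "\<exists>z. m < z \<and> z < b \<and> (\<lambda>y. f' z * y) = (\<lambda>v. 0)"
    proof (rule Rolle_deriv[OF m(3)])
      show "f m = f b" using insert.prems m by simp
      show "continuous_on {m..b} f"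
        by (rule continuous_on_subset[OF _ sub])
          (meson DERIV_continuous continuous_on_eq_continuous_within der)
      fix t assume t: "m < t" "t < b"
      \<comment> \<open>At interior points the derivative within the interval is the two-sided
        derivative that Rolle's theorem asks for.\<close>
      then have "t \<in> interior {u..v}"
        using sub by (intro interiorI[of "{m<..<b}"]) auto
      then show "(f has_derivative (\<lambda>y. f' t * y)) (at t)"
        using der[of t] sub t at_within_interior[of t "{u..v}"]
        by (auto simp: has_field_derivative_def)
    qed
    then obtain z where z: "m < z" "z < b" "f' z = 0"
      by (metis mult_cancel_left2 mult.right_neutral)
    have "z \<notin> T" "z \<notin> A" "b \<notin> A"
      using T(6) m z by force+
    moreover have "b \<notin> T"
      using T(6) insert.hyps by force
    ultimately show ?thesis
      using T z m sub insert.hyps by (intro exI[of _ "insert z T"]) auto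
  qed
qed

lemma Rolle_simple_zeros:
  fixes D :: "nat \<Rightarrow> real \<Rightarrow> real"
  assumes "finite Z" "card Z = Suc N" "Z \<subseteq> {u..v}" "\<And>z. z \<in> Z \<Longrightarrow> D 0 z = 0"
    and "\<And>k t. k < N \<Longrightarrow> t \<in> {u..v} \<Longrightarrow>
      (D k has_real_derivative D (Suc k) t) (at t within {u..v})"
  shows "\<exists>\<eta>\<in>{u..v}. D N \<eta> = 0"
  using assms
proof (induction N arbitrary: Z D)
  case 0
  then show ?case by (auto simp: card_1_singleton_iff)
next
  case (Suc N)
  then have "Z \<noteq> {}" by auto
  obtain T where T: "finite T" "Suc (card T) = card Z" "T \<subseteq> {u..v}" "\<forall>t\<in>T. D 1 t = 0"
    using Rolle_finite_set[of Z u v "D 0" "D 1"] \<open>Z \<noteq> {}\<close> Suc.prems(1,3,4) Suc.prems(5)[of 0]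
    by auto
  show ?case
    using T Suc.prems by (intro Suc.IH[of T "\<lambda>k. D (Suc k)"]) auto
qed

text \<open>Here \<open>x\<close> is a zero of multiplicity \<open>m\<close> and \<open>Z\<close> a
  set of further zeros. Rolle on \<open>insert x Z\<close> gives \<open>card Z\<close> zeros of
  \<open>D 1\<close> away from \<open>x\<close>, while the multiplicity at \<open>x\<close> drops by
  one; so \<open>m + card Z\<close> and \<open>N\<close> decrease together until
  \<open>m = 0\<close>.\<close>

lemma Rolle_multiplicity:
  fixes D :: "nat \<Rightarrow> real \<Rightarrow> real"
  assumes "finite Z" "m + card Z = Suc N" "Z \<subseteq> {u..v}" "x \<in> {u..v}" "x \<notin> Z"
    and "\<And>z. z \<in> Z \<Longrightarrow> D 0 z = 0" "\<And>k. k < m \<Longrightarrow> D k x = 0"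
    and "\<And>k t. k < N \<Longrightarrow> t \<in> {u..v} \<Longrightarrow>
      (D k has_real_derivative D (Suc k) t) (at t within {u..v})"
  shows "\<exists>\<eta>\<in>{u..v}. D N \<eta> = 0"
  using assms
proof (induction m arbitrary: Z D N)
  case 0
  then show ?case using Rolle_simple_zeros[of Z N u v D] by simp
next
  case (Suc m)
  show ?case
  proof (cases N)
    case 0
    \<comment> \<open>The count leaves \<open>Z\<close> empty and \<open>m = 0\<close>, so
      \<open>x\<close> itself is the required zero.\<close>
    then show ?thesis using Suc.prems by auto
  next
    case (Suc N')
    let ?S = "insert x Z"
    note prems = Suc.prems
    have S: "finite ?S" "?S \<noteq> {}" "?S \<subseteq> {u..v}" "\<And>s. s \<in> ?S \<Longrightarrow> D 0 s = 0"
      using prems by auto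
    obtain T where T: "finite T" "Suc (card T) = card ?S" "T \<subseteq> {u..v}" "T \<inter> ?S = {}"
      "\<forall>t\<in>T. D 1 t = 0"
      using Rolle_finite_set[of ?S u v "D 0" "D 1"] S prems(8)[of 0] Suc by auto
    have "card T = card Z"
      using T(2) prems(1,5) by simp
    then show ?thesis
      using T prems unfolding Suc by (intro Suc.IH[of T N' "\<lambda>k. D (Suc k)"]) auto
  qed
qed

section \<open>Expansion of the scheme values\<close>

lemma higher_pderiv_pcompose_shift:
  "(pderiv ^^ k) (pcompose P [:c, 1:]) = pcompose ((pderiv ^^ k) P) [:c, 1:]"
  for P :: "real poly"
  by (induction k) (simp_all add: pderiv_pcompose pderiv_pCons)

lemma higher_pderiv_degree_le:
  fixes P :: "real poly"
  assumes "degree P \<le> m"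
  shows "(pderiv ^^ m) P = [:fact m * coeff P m:]"
proof (rule poly_eqI)
  fix k
  show "coeff ((pderiv ^^ m) P) k = coeff [:fact m * coeff P m:] k"
    using assms
    by (cases k) (simp_all add: coeff_higher_pderiv pochhammer_fact coeff_eq_0)
qed

text \<open>The defect \<open>y\<close> between the scheme value and the convolution appears, up to
  the factor \<open>- 1 / w\<close>, as the top coefficient of a Hermite interpolant; Rolle's
  theorem identifies that coefficient with a derivative value.\<close>

lemma scheme_expansion:
  fixes D :: "nat \<Rightarrow> real \<Rightarrow> real"
  assumes inj: "inj_on xs {..n}" and nodes: "\<And>j. j \<le> n \<Longrightarrow> xs j \<in> {u..v}"
    and x: "x \<in> {u..v}" and neq: "\<And>j. j \<le> n \<Longrightarrow> x \<noteq> xs j"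
    and der: "\<And>k t. k \<le> n + r \<Longrightarrow> t \<in> {u..v} \<Longrightarrow>
      (D k has_real_derivative D (Suc k) t) (at t within {u..v})"
  shows "\<exists>\<eta>\<in>{u..v}. Nt_val (D 0) xs n r x + (\<Prod>i\<le>n. x - xs i) * (D (n + 1 + r) \<eta> / fact (n + 1 + r)) =
    (\<Sum>s\<le>r. D s x / fact s * N_val xs n (r - s) x)"
proof -
  define c where "c s = D s x / fact s" for s
  define w where "w = (\<Prod>i\<le>n. x - xs i)"
  have "w \<noteq> 0"
    using neq by (auto simp: w_def)
  have "\<exists>L. degree L \<le> n \<and> (\<forall>k\<le>n. poly L (xs k) = val k) \<and> poly L x = neville xs x val n 0" for val
    using neville_interpolates[of xs 0 n val x] inj by (auto simp: atLeast0AtMost)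
  then obtain LL where LL: "\<And>val. degree (LL val) \<le> n"
    "\<And>val k. k \<le> n \<Longrightarrow> poly (LL val) (xs k) = val k"
    "\<And>val. poly (LL val) x = neville xs x val n 0"
    by metis
  \<comment> \<open>By linearity \<open>L\<close> interpolates the Taylor remainder of order
    \<open>r\<close> at \<open>x\<close> divided by \<open>(xs j - x) ^ r\<close>.\<close>
  define L where "L = LL (\<lambda>j. D 0 (xs j) / (xs j - x) ^ r)
    - (\<Sum>s\<le>r. smult (c s) (LL (\<lambda>j. 1 / (xs j - x) ^ (r - s))))"
  define y where "y = Nt_val (D 0) xs n r x - (\<Sum>s\<le>r. c s * N_val xs n (r - s) x)"
  have degL: "degree L \<le> n"
    unfolding L_def
    by (intro degree_diff_le degree_sum_le LL(1) order.trans[OF degree_smult_le]) auto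
  have Lx: "poly L x = y"
    by (simp add: L_def y_def poly_sum LL(3) Nt_val_def N_val_def)
  have Lxs: "(xs j - x) ^ r * poly L (xs j) + (\<Sum>s\<le>r. c s * (xs j - x) ^ s) = D 0 (xs j)"
    if "j \<le> n" for j
  proof -
    have "(\<Sum>s\<le>r. c s * (xs j - x) ^ s) = (xs j - x) ^ r * (\<Sum>s\<le>r. c s * (1 / (xs j - x) ^ (r - s)))"
      unfolding sum_distrib_left
      by (intro sum.cong) (use neq[OF that] in \<open>auto simp: power_diff\<close>)
    then show ?thesis
      using neq[OF that] that by (simp add: L_def poly_sum LL(2) algebra_simps)
  qed

  text \<open>\<open>P\<close> is the Hermite interpolant of degree \<open>n + r + 1\<close> matching \<open>D 0\<close> at the nodes and to
    order \<open>r\<close> at \<open>x\<close>, and \<open>P0\<close> is its shift to the origin.\<close>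
  define W where "W = (\<Prod>i\<le>n. [:x - xs i, 1:])"
  define M where "M = pcompose L [:x, 1:] - smult (y / w) W"
  define P0 where "P0 = (\<Sum>s\<le>r. monom (c s) s) + monom 1 r * M"
  define P where "P = pcompose P0 [:-x, 1:]"
  define E where "E k t = D k t - poly ((pderiv ^^ k) P) t" for k t

  have degW: "degree W = Suc n" and lcW: "coeff W (Suc n) = 1"
  proof -
    show *: "degree W = Suc n"
      unfolding W_def by (subst degree_prod_eq_sum_degree) auto
    show "coeff W (Suc n) = 1"
      using lead_coeff_prod[of "\<lambda>i. [:x - xs i, 1:]" "{..n}"] * by (simp add: W_def)
  qed
  have degL': "degree (pcompose L [:x, 1:]) \<le> n"
    using degL by (simp add: degree_pcompose)
  have degM: "degree M \<le> Suc n"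
    unfolding M_def using degL' degW
    by (intro degree_diff_le order.trans[OF degree_smult_le]) auto
  \<comment> \<open>The factor \<open>y / w\<close> is chosen for this: \<open>W\<close> has value
    \<open>w\<close> at 0 and the shifted \<open>L\<close> has value \<open>y\<close>. Hence
    \<open>monom 1 r * M\<close> leaves the coefficients of \<open>P0\<close> up to degree
    \<open>r\<close> untouched.\<close>
  have M0: "coeff M 0 = 0"
    using \<open>w \<noteq> 0\<close> Lx
    by (simp add: M_def W_def w_def poly_0_coeff_0[symmetric] poly_pcompose poly_prod)
  have M_top: "coeff M (Suc n) = - (y / w)"
    using degL' by (simp add: M_def lcW coeff_eq_0)
  have coeffP0: "coeff P0 k = (if k \<le> r then c k else coeff M (k - r))" for k
    using M0 by (auto simp: P0_def coeff_sum coeff_monom_mult)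
  have degP0: "degree P0 \<le> n + 1 + r"
    by (rule degree_le) (use degM in \<open>auto simp: coeffP0 coeff_eq_0\<close>)
  have P_deriv: "poly ((pderiv ^^ k) P) t = poly ((pderiv ^^ k) P0) (t - x)" for k t
    by (simp add: P_def higher_pderiv_pcompose_shift poly_pcompose)

  \<comment> \<open>The error \<open>E\<close> has \<open>n + 1\<close> zeros at the nodes and a
    zero of multiplicity \<open>r + 1\<close> at \<open>x\<close>.\<close>
  have "\<exists>\<eta>\<in>{u..v}. E (n + 1 + r) \<eta> = 0"
  proof (rule Rolle_multiplicity[of "xs ` {..n}" "Suc r"])
    show "Suc r + card (xs ` {..n}) = Suc (n + 1 + r)"
      using inj by (simp add: card_image)
    show "E 0 z = 0" if "z \<in> xs ` {..n}" for z
    proof -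
      obtain j where j: "z = xs j" "j \<le> n" using \<open>z \<in> xs ` {..n}\<close> by auto
      have "poly W (xs j - x) = 0"
        using j(2) by (auto simp: W_def poly_prod)
      then have "poly M (xs j - x) = poly L (xs j)"
        by (simp add: M_def poly_pcompose)
      then show ?thesis
        using Lxs[OF j(2)] P_deriv[of 0 z] j(1)
        by (simp add: E_def P0_def poly_sum poly_monom algebra_simps)
    qed
    show "E k x = 0" if "k < Suc r" for k
      using that
      by (simp add: E_def P_deriv poly_0_coeff_0 coeff_higher_pderiv pochhammer_fact[symmetric] coeffP0 c_def)
    show "(E k has_real_derivative E (Suc k) t) (at t within {u..v})"
      if "k < n + 1 + r" "t \<in> {u..v}" for k t
      unfolding E_def using that
      by (auto intro!: derivative_eq_intros der poly_DERIV[THEN DERIV_subset])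
  qed (use nodes x neq in auto)
  then obtain \<eta> where \<eta>: "\<eta> \<in> {u..v}" "E (n + 1 + r) \<eta> = 0"
    by blast
  have "coeff P0 (n + 1 + r) = - (y / w)"
    using M_top by (simp add: coeffP0)
  then have "D (n + 1 + r) \<eta> = fact (n + 1 + r) * - (y / w)"
    using \<eta>(2) by (simp only: E_def P_deriv higher_pderiv_degree_le[OF degP0]) simp
  then have "w * (D (n + 1 + r) \<eta> / fact (n + 1 + r)) = - y"
    using \<open>w \<noteq> 0\<close> by simp
  then show ?thesis
    using \<eta>(1) unfolding w_def y_def c_def by (intro bexI[of _ \<eta>]) auto
qed

section \<open>The quadrature formula\<close>

text \<open>As power series, the product of \<open>a\<close> and \<open>N\<close> is 1 up to order
  \<open>n\<close>, so multiplying the product of \<open>c\<close> and \<open>N\<close> by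
  \<open>a\<close> returns \<open>c\<close> to that order. Coefficients beyond \<open>n\<close> are
  arbitrary and never enter.\<close>

lemma convolution_inverse:
  fixes a N b c :: "nat \<Rightarrow> real"
  assumes "N 0 = 1" "a 0 = 1"
    and a: "\<And>k. k \<in> {1..n} \<Longrightarrow> a k = - (\<Sum>m<k. a m * N (k - m))"
    and b: "\<And>k. k \<le> n \<Longrightarrow> b k = (\<Sum>s\<le>k. c s * N (k - s))"
    and "k \<le> n"
  shows "c k = (\<Sum>m\<le>k. a m * b (k - m))"
proof -
  have one: "fps_nth (Abs_fps a * Abs_fps N) i = (if i = 0 then 1 else 0)" if "i \<le> n" for i
  proof (cases "i = 0")
    case False
    \<comment> \<open>The last summand is \<open>a i * N 0 = a i\<close>, which the recursion makes
      cancel the others.\<close>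
    have "fps_nth (Abs_fps a * Abs_fps N) i = (\<Sum>m<Suc i. a m * N (i - m))"
      by (simp add: fps_mult_nth atLeast0AtMost lessThan_Suc_atMost)
    then show ?thesis
      using False a[of i] that assms(1) by simp
  qed (use assms in simp)
  have "(\<Sum>m\<le>k. a m * b (k - m)) = fps_nth (Abs_fps a * (Abs_fps c * Abs_fps N)) k"
    using \<open>k \<le> n\<close> by (simp add: fps_mult_nth atLeast0AtMost b)
  also have "\<dots> = fps_nth ((Abs_fps a * Abs_fps N) * Abs_fps c) k"
    by (simp add: mult_ac)
  also have "\<dots> = (\<Sum>i\<le>k. fps_nth (Abs_fps a * Abs_fps N) i * c (k - i))"
    by (subst fps_mult_nth) (simp add: atLeast0AtMost)
  also have "\<dots> = (\<Sum>i\<le>k. if i = 0 then c k else 0)"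
    using \<open>k \<le> n\<close> by (intro sum.cong) (auto simp: one)
  finally show ?thesis by simp
qed

text \<open>Both sides sum \<open>b j * a m * h ^ (j + m + 1) / (j + m + 1)\<close> over
  \<open>j + m \<le> n\<close>, grouped by \<open>j\<close> on the left and by \<open>j + m\<close>
  on the right.\<close>

lemma sum_gamma_coeff:
  "(\<Sum>k\<le>n. b k * gamma_coeff a n h k) =
    (\<Sum>k\<le>n. (\<Sum>m\<le>k. a m * b (k - m)) * (h ^ (k + 1) / real (k + 1)))"
proof -
  have comm: "(\<Sum>m\<le>k. a m * b (k - m)) = (\<Sum>m\<le>k. b m * a (k - m))" for k
    by (rule sum.reindex_bij_witness[of _ "\<lambda>m. k - m" "\<lambda>m. k - m"]) auto
  have "(\<Sum>k\<le>n. (\<Sum>m\<le>k. a m * b (k - m)) * (h ^ (k + 1) / real (k + 1))) =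
      (\<Sum>k\<le>n. \<Sum>m\<le>k. b m * a (k - m) * (h ^ (k + 1) / real (k + 1)))"
    by (simp only: comm sum_distrib_right)
  also have "\<dots> = (\<Sum>k\<le>n. \<Sum>m\<le>k. b m * a (k - m) * (h ^ (m + (k - m) + 1) / real (m + (k - m) + 1)))"
    by (intro sum.cong) auto
  also have "\<dots> = (\<Sum>(j, m)\<in>{(j, m). j + m \<le> n}. b j * a m * (h ^ (j + m + 1) / real (j + m + 1)))"
    by (rule sum.triangle_reindex_eq[symmetric])
  also have "{(j, m). j + m \<le> n} = (SIGMA j:{..n}. {..n - j})"
    by auto
  also have "(\<Sum>(j, m)\<in>(SIGMA j:{..n}. {..n - j}). b j * a m * (h ^ (j + m + 1) / real (j + m + 1))) =
      (\<Sum>j\<le>n. \<Sum>m\<le>n - j. b j * a m * (h ^ (j + m + 1) / real (j + m + 1)))"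
    by (rule sum.Sigma[symmetric]) auto
  also have "\<dots> = (\<Sum>k\<le>n. b k * gamma_coeff a n h k)"
    unfolding gamma_coeff_def sum_distrib_left by (simp add: mult.assoc)
  finally show ?thesis ..
qed

text \<open>Integrating Taylor's formula for \<open>D 0\<close> amounts to Taylor's formula of one
  order more for an antiderivative \<open>G\<close>, which treats both signs of \<open>h\<close> at
  once.\<close>

lemma integral_Taylor_bound:
  fixes D :: "nat \<Rightarrow> real \<Rightarrow> real"
  assumes x: "x \<in> {p..q}"
    and der: "\<And>k t. k \<le> n \<Longrightarrow> t \<in> {p..q} \<Longrightarrow>
      (D k has_real_derivative D (Suc k) t) (at t within {p..q})"
    and cont: "continuous_on {p..q} (D 0)" "continuous_on {p..q} (D (Suc n))"
  shows "\<exists>C. \<forall>h. x + h \<in> {p..q} \<longrightarrow>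
    \<bar>(LBINT s=ereal x..ereal (x + h). D 0 s)
      - (\<Sum>k\<le>n. D k x / fact k * (h ^ (k + 1) / real (k + 1)))\<bar> \<le> C * \<bar>h\<bar> ^ (n + 2)"
proof -
  obtain G where G: "\<And>t. t \<in> {p..q} \<Longrightarrow> (G has_vector_derivative D 0 t) (at t within {p..q})"
    using antiderivative_continuous[OF cont(1)] by blast
  have "bounded (D (Suc n) ` {p..q})"
    by (rule compact_imp_bounded[OF compact_continuous_image[OF cont(2) compact_Icc]])
  then obtain B where B: "\<And>t. t \<in> {p..q} \<Longrightarrow> norm (D (Suc n) t) \<le> B"
    unfolding bounded_iff by (metis imageI)
  show ?thesis
  proof (intro exI[of _ "B / fact (n + 1)"] allI impI)
    fix h assume h: "x + h \<in> {p..q}"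
    have sub: "{min x (x + h)..max x (x + h)} \<subseteq> {p..q}"
      using x h by auto
    have int: "(LBINT s=ereal x..ereal (x + h). D 0 s) = G (x + h) - G x"
    proof (rule interval_integral_FTC_finite)
      show "continuous_on {min x (x + h)..max x (x + h)} (D 0)"
        by (rule continuous_on_subset[OF cont(1) sub])
      show "(G has_vector_derivative D 0 t) (at t within {min x (x + h)..max x (x + h)})"
        if "min x (x + h) \<le> t" "t \<le> max x (x + h)" for t
        by (rule has_vector_derivative_within_subset[OF G sub]) (use that sub in auto)
    qed
    define F where "F = case_nat G D"
    \<comment> \<open>\<open>B\<close> bounds \<open>D (Suc n)\<close>, which is the derivative of
      order \<open>n + 2\<close> in the sequence \<open>F\<close> starting at
      \<open>G\<close>.\<close>
    have "norm (F 0 (x + h) - (\<Sum>i\<le>n + 1. F i x * (x + h - x) ^ i / fact i))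
        \<le> B * norm (x + h - x) ^ Suc (n + 1) / fact (n + 1)"
    proof (rule field_Taylor[of "{p..q}"])
      show "(F i has_field_derivative F (Suc i) t) (at t within {p..q})"
        if "t \<in> {p..q}" "i \<le> n + 1" for i t
        using that G der
        by (cases i) (auto simp: F_def has_real_derivative_iff_has_vector_derivative)
    qed (use x h B in \<open>auto simp: F_def\<close>)
    moreover have "(\<Sum>i\<le>n + 1. F i x * (x + h - x) ^ i / fact i) =
        G x + (\<Sum>k\<le>n. D k x / fact k * (h ^ (k + 1) / real (k + 1)))"
      unfolding Suc_eq_plus1[symmetric] sum.atMost_Suc_shift by (simp add: F_def algebra_simps)
    ultimately have "\<bar>G (x + h) - (G x + (\<Sum>k\<le>n. D k x / fact k * (h ^ (k + 1) / real (k + 1))))\<bar>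
        \<le> B * \<bar>h\<bar> ^ (n + 2) / fact (n + 1)"
      by (simp add: F_def)
    then show "\<bar>(LBINT s=ereal x..ereal (x + h). D 0 s)
      - (\<Sum>k\<le>n. D k x / fact k * (h ^ (k + 1) / real (k + 1)))\<bar> \<le> B / fact (n + 1) * \<bar>h\<bar> ^ (n + 2)"
      unfolding int by (simp only: diff_diff_eq times_divide_eq_left)
  qed
qed

lemma C_on_has_real_derivative:
  assumes "C_on m S f" "k < m" "t \<in> S"
  shows "(iter_deriv_on S k f has_real_derivative iter_deriv_on S (Suc k) f t) (at t within S)"
proof -
  have "iter_deriv_on S k f differentiable (at t within S)"
    using assms by (auto simp: C_on_def differentiable_on_def)
  then show ?thesis
    by (simp add: vector_derivative_works iter_deriv_on_def has_real_derivative_iff_has_vector_derivative)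
qed

text \<open>With the scheme values corrected to \<open>b\<close>, the \<open>\<gamma>\<close> sum
  equals the integrated Taylor polynomial exactly, so the error is the Taylor remainder
  alone.\<close>

lemma neville_quadrature:
  fixes xs :: "nat \<Rightarrow> real"
  assumes nodes: "\<forall>j\<le>n. xs j \<in> {p..q}" and inj: "inj_on xs {..n}"
    and x: "x \<in> {p..q}" and neq: "\<forall>j\<le>n. x \<noteq> xs j" and C: "C_on (2 * n + 1) {p..q} f"
    and a: "a 0 = 1" "\<forall>k\<in>{1..n}. a k = - (\<Sum>m<k. a m * N_val xs n (k - m) x)"
  shows "\<exists>C. \<forall>h. h \<noteq> 0 \<and> x + h \<in> {p..q} \<longrightarrow>
          (\<exists>\<xi> :: nat \<Rightarrow> real. (\<forall>k\<le>n. \<xi> k \<in> hull_interval xs n x) \<and>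
             \<bar>(LBINT s=ereal x..ereal (x + h). f s)
               - ((\<Sum>k\<le>n. Nt_val f xs n k x * gamma_coeff a n h k)
                  + (\<Prod>i\<le>n. x - xs i) *
                    (\<Sum>k\<le>n. iter_deriv_on {p..q} (n + 1 + k) f (\<xi> (n - k)) / fact (n + 1 + k)
                            * gamma_coeff a n h k))\<bar>
             \<le> C * \<bar>h\<bar> ^ (n + 2))"
proof -
  define D where "D k = iter_deriv_on {p..q} k f" for k
  have D0: "D 0 = f"
    by (simp add: D_def iter_deriv_on_def)
  have der: "(D k has_real_derivative D (Suc k) t) (at t within {p..q})"
    if "k < 2 * n + 1" "t \<in> {p..q}" for k t
    unfolding D_def by (rule C_on_has_real_derivative[OF C that])
  have cont: "continuous_on {p..q} (D k)" if "k \<le> 2 * n + 1" for k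
    using C that by (auto simp: C_on_def D_def)
  define u v where "u = Min (insert x (xs ` {..n}))" and "v = Max (insert x (xs ` {..n}))"
  have hull: "hull_interval xs n x = {u..v}"
    by (simp add: hull_interval_def u_def v_def)
  have in_hull: "x \<in> {u..v}" "\<And>j. j \<le> n \<Longrightarrow> xs j \<in> {u..v}"
    by (auto simp: u_def v_def simp del: Min_insert Max_insert intro!: Min_le Max_ge)
  \<comment> \<open>The end points of the hull are themselves among the given points, so the hull
    lies in \<open>{p..q}\<close>.\<close>
  have "u \<in> insert x (xs ` {..n})" "v \<in> insert x (xs ` {..n})"
    unfolding u_def v_def by (rule Min_in Max_in; simp)+
  then have sub: "{u..v} \<subseteq> {p..q}"
    using nodes x by auto

  define w where "w = (\<Prod>i\<le>n. x - xs i)"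
  \<comment> \<open>For \<open>r \<le> n\<close> the order \<open>n + 1 + r\<close> is at most
    \<open>2 * n + 1\<close>, the smoothness assumed of \<open>f\<close>.\<close>
  have "\<exists>\<eta>\<in>{u..v}. Nt_val f xs n r x + w * (D (n + 1 + r) \<eta> / fact (n + 1 + r)) =
    (\<Sum>s\<le>r. D s x / fact s * N_val xs n (r - s) x)" if "r \<le> n" for r
    unfolding D0[symmetric] w_def
  proof (rule scheme_expansion[OF inj in_hull(2,1)])
    show "(D k has_real_derivative D (Suc k) t) (at t within {u..v})"
      if "k \<le> n + r" "t \<in> {u..v}" for k t
      by (rule DERIV_subset[OF der sub]) (use that \<open>r \<le> n\<close> sub in auto)
  qed (use neq in auto)
  then have "\<forall>r\<in>{..n}. \<exists>\<eta>. \<eta> \<in> {u..v} \<and>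
      Nt_val f xs n r x + w * (D (n + 1 + r) \<eta> / fact (n + 1 + r)) =
      (\<Sum>s\<le>r. D s x / fact s * N_val xs n (r - s) x)"
    by (simp add: Bex_def)
  from bchoice[OF this] obtain \<eta> where \<eta>: "\<And>r. r \<le> n \<Longrightarrow> \<eta> r \<in> {u..v}"
    "\<And>r. r \<le> n \<Longrightarrow> Nt_val f xs n r x + w * (D (n + 1 + r) (\<eta> r) / fact (n + 1 + r)) =
      (\<Sum>s\<le>r. D s x / fact s * N_val xs n (r - s) x)"
    by blast
  define b where "b r = Nt_val f xs n r x + w * (D (n + 1 + r) (\<eta> r) / fact (n + 1 + r))" for r
  have inv: "D k x / fact k = (\<Sum>m\<le>k. a m * b (k - m))" if "k \<le> n" for k
    by (rule convolution_inverse[of "\<lambda>k. N_val xs n k x" a n b "\<lambda>k. D k x / fact k", OF _ a(1)])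
      (use a(2) \<eta>(2) that in \<open>auto simp: b_def N_val_0[OF inj]\<close>)

  obtain K where K: "\<And>h. x + h \<in> {p..q} \<Longrightarrow>
    \<bar>(LBINT s=ereal x..ereal (x + h). D 0 s)
      - (\<Sum>k\<le>n. D k x / fact k * (h ^ (k + 1) / real (k + 1)))\<bar> \<le> K * \<bar>h\<bar> ^ (n + 2)"
    using integral_Taylor_bound[OF x, of n D] der cont by auto
  show ?thesis
  proof (intro exI[of _ K] exI[of _ "\<lambda>k. \<eta> (n - k)"] conjI allI impI)
    show "\<eta> (n - k) \<in> hull_interval xs n x" for k
      unfolding hull by (rule \<eta>(1)) simp
    fix h assume h: "h \<noteq> 0 \<and> x + h \<in> {p..q}"
    have "(\<Sum>k\<le>n. D k x / fact k * (h ^ (k + 1) / real (k + 1))) = (\<Sum>k\<le>n. b k * gamma_coeff a n h k)"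
      unfolding sum_gamma_coeff using inv by (intro sum.cong) auto
    also have "\<dots> = (\<Sum>k\<le>n. Nt_val f xs n k x * gamma_coeff a n h k) + w *
        (\<Sum>k\<le>n. D (n + 1 + k) (\<eta> (n - (n - k))) / fact (n + 1 + k) * gamma_coeff a n h k)"
      unfolding sum_distrib_left sum.distrib[symmetric]
      by (intro sum.cong) (auto simp: b_def algebra_simps)
    finally show "\<bar>(LBINT s=ereal x..ereal (x + h). f s)
               - ((\<Sum>k\<le>n. Nt_val f xs n k x * gamma_coeff a n h k)
                  + (\<Prod>i\<le>n. x - xs i) *
                    (\<Sum>k\<le>n. iter_deriv_on {p..q} (n + 1 + k) f (\<eta> (n - (n - k))) / fact (n + 1 + k)
                            * gamma_coeff a n h k))\<bar>
             \<le> K * \<bar>h\<bar> ^ (n + 2)"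
      using K[of h] h unfolding D0 w_def[symmetric] D_def[symmetric] by simp
  qed
qed

theorem theorem5p1:
  fixes n :: nat and p q x :: real and xs :: "nat \<Rightarrow> real" and f :: "real \<Rightarrow> real"
  assumes "\<forall>j\<le>n. xs j \<in> {p..q}"
    and "inj_on xs {..n}"
    and "x \<in> {p..q}"
    and "\<forall>j\<le>n. x \<noteq> xs j"
    and "C_on (2 * n + 1) {p..q} f"
  shows
    "(\<forall>a :: nat \<Rightarrow> real.
        a 0 = 1 \<and> (\<forall>k\<in>{1..n}. a k = - (\<Sum>m<k. a m * N_val xs n (k - m) x)) \<longrightarrow>
        (\<exists>C. \<forall>h. h \<noteq> 0 \<and> x + h \<in> {p..q} \<longrightarrow>
          (\<exists>\<xi> :: nat \<Rightarrow> real. (\<forall>k\<le>n. \<xi> k \<in> hull_interval xs n x) \<and>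
             \<bar>(LBINT s=ereal x..ereal (x + h). f s)
               - ((\<Sum>k\<le>n. Nt_val f xs n k x * gamma_coeff a n h k)
                  + (\<Prod>i\<le>n. x - xs i) *
                    (\<Sum>k\<le>n. iter_deriv_on {p..q} (n + 1 + k) f (\<xi> (n - k)) / fact (n + 1 + k)
                            * gamma_coeff a n h k))\<bar>
             \<le> C * \<bar>h\<bar> ^ (n + 2))))
   \<and>
     (\<forall>a :: nat \<Rightarrow> real.
        a 0 = 1 \<and> (\<forall>k\<in>{1..n}. a k = - (\<Sum>m<k. a m * A_val xs n (k - m) x)) \<longrightarrow>
        (\<exists>C. \<forall>h. h \<noteq> 0 \<and> x + h \<in> {p..q} \<longrightarrow>
          (\<exists>\<xi> :: nat \<Rightarrow> real. (\<forall>k\<le>n. \<xi> k \<in> hull_interval xs n x) \<and>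
             \<bar>(LBINT s=ereal x..ereal (x + h). f s)
               - ((\<Sum>k\<le>n. At_val f xs n k x * gamma_coeff a n h k)
                  + (\<Prod>i\<le>n. x - xs i) *
                    (\<Sum>k\<le>n. iter_deriv_on {p..q} (n + 1 + k) f (\<xi> (n - k)) / fact (n + 1 + k)
                            * gamma_coeff a n h k))\<bar>
             \<le> C * \<bar>h\<bar> ^ (n + 2))))"
proof -
  \<comment> \<open>The schemes agree on every starting column, so both halves of the claim become
    the same statement.\<close>
  have "A_val xs n r x = N_val xs n r x" "At_val f xs n r x = Nt_val f xs n r x" for r
    by (simp_all add: A_val_def N_val_def At_val_def Nt_val_def aitken_eq_neville[OF assms(2)])
  then show ?thesis
    using neville_quadrature[OF assms] by simp
qed

end
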